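(* Let $m,n\ge 1$ be integers and let $A\in \mathbb{M}_m(\mathbb{M}_n)$ be positive semidefinite. Then \[ (\mathrm{tr}\,A)I_{mn}-(\mathrm{tr}_2 A)\otimes I_n\ \ge\ A-I_m\otimes(\mathrm{tr}_1 A)+2\bigl(I_m\otimes \mathrm{tr}_1 A-A\bigr)\circ J, \] where $J\in\mathbb{M}_m(\mathbb{M}_n)$ is the $m\times m$ block matrix with each block equal to $I_n$.
   Context: $\mathbb{M}_n$ is the space of $n\times n$ complex matrices. $\mathbb{M}_m(\mathbb{M}_n)$ is the set of $m\times m$ block matrices $A=[A_{i,j}]_{i,j=1}^m$ with blocks $A_{i,j}\in\mathbb{M}_n$, regarded also as $mn\times mn$ complex matrices. For Hermitian $X,Y$ of the same size, $X\ge Y$ means $X-Y$ is positive semidefinite. $\mathrm{tr}$ is the usual trace. The partial traces are $\mathrm{tr}_1 A=\sum_{i=1}^m A_{i,i}\in\mathbb{M}_n$ and $\mathrm{tr}_2 A=[\mathrm{tr}\,A_{i,j}]_{i,j=1}^m\in\mathbb{M}_m$. $\otimes$ is the Kronecker product: for $X=[x_{i,j}]\in\mathbb{M}_m$ and $Y\in\mathbb{M}_n$, $X\otimes Y\in\mathbb{M}_m(\mathbb{M}_n)$ has $(i,j)$ block $x_{i,j}Y$. $\circ$ is the Hadamard (entrywise) product of $mn\times mn$ matrices. *)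

theory Defs
  imports "HOL-Analysis.Analysis"
begin

text \<open>
  The dimensions \<open>m\<close> and \<open>n\<close> are the cardinalities of arbitrary finite (hence nonempty) index
  types \<open>'m\<close> and \<open>'n\<close>.  An \<open>m \<times> m\<close> block matrix with \<open>n \<times> n\<close> blocks, regarded as an
  \<open>mn \<times> mn\<close> matrix, is indexed by pairs: the entry at row \<open>(i, k)\<close> and column \<open>(j, l)\<close> is the
  \<open>(k, l)\<close> entry of block \<open>(i, j)\<close>.
\<close>

type_synonym 'n cmatrix = "complex ^ 'n ^ 'n"

type_synonym ('m, 'n) block_matrix = "complex ^ ('m \<times> 'n) ^ ('m \<times> 'n)"

definition block :: "('m::finite, 'n::finite) block_matrix \<Rightarrow> 'm \<Rightarrow> 'm \<Rightarrow> 'n cmatrix" where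
  "block A i j = (\<chi> k l. A $ (i, k) $ (j, l))"

definition of_blocks :: "('m \<Rightarrow> 'm \<Rightarrow> 'n cmatrix) \<Rightarrow> ('m::finite, 'n::finite) block_matrix" where
  "of_blocks B = (\<chi> p q. B (fst p) (fst q) $ snd p $ snd q)"

definition ptrace1 :: "('m::finite, 'n::finite) block_matrix \<Rightarrow> 'n cmatrix" where
  "ptrace1 A = (\<Sum>i\<in>UNIV. block A i i)"

definition ptrace2 :: "('m::finite, 'n::finite) block_matrix \<Rightarrow> 'm cmatrix" where
  "ptrace2 A = (\<chi> i j. trace (block A i j))"

definition cscale :: "complex \<Rightarrow> 'n::finite cmatrix \<Rightarrow> 'n cmatrix" where
  "cscale c A = (\<chi> i j. c * A $ i $ j)"

definition kronecker :: "'m::finite cmatrix \<Rightarrow> 'n::finite cmatrix \<Rightarrow> ('m, 'n) block_matrix" where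
  "kronecker X Y = of_blocks (\<lambda>i j. cscale (X $ i $ j) Y)"

definition hadamard :: "'n::finite cmatrix \<Rightarrow> 'n cmatrix \<Rightarrow> 'n cmatrix" where
  "hadamard A B = (\<chi> i j. A $ i $ j * B $ i $ j)"

definition hermitian :: "'n::finite cmatrix \<Rightarrow> bool" where
  "hermitian A \<longleftrightarrow> (\<forall>i j. A $ i $ j = cnj (A $ j $ i))"

text \<open>For Hermitian \<open>A\<close> the quadratic form \<open>x\<^sup>* A x\<close> is real, so taking \<open>Re\<close> loses nothing.\<close>

definition psd :: "'n::finite cmatrix \<Rightarrow> bool" where
  "psd A \<longleftrightarrow> hermitian A \<and> (\<forall>x :: complex ^ 'n. 0 \<le> Re (\<Sum>i\<in>UNIV. cnj (x $ i) * (A *v x) $ i))"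

definition loewner_ge :: "'n::finite cmatrix \<Rightarrow> 'n cmatrix \<Rightarrow> bool" where
  "loewner_ge X Y \<longleftrightarrow> hermitian X \<and> hermitian Y \<and> psd (X - Y)"

definition block_J :: "('m::finite, 'n::finite) block_matrix" where
  "block_J = of_blocks (\<lambda>i j. mat 1)"

end

theory Submission
  imports Defs
begin

text \<open>
  Write \<open>x \<in> \<complex>\<^sup>m \<otimes> \<complex>\<^sup>n\<close> as a family of columns \<open>x\<^sub>k \<in> \<complex>\<^sup>m\<close>, one for each index \<open>k\<close> inside the
  blocks, with entries \<open>x\<^sub>i\<^sub>k\<close>.  The gap between the two sides is linear in \<open>A\<close>, so the case
  \<open>A = v v\<^sup>*\<close> shows what to expect.  There the quadratic form of the gap at \<open>x\<close> is a sum over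
  ordered pairs of column indices \<open>k\<close>, \<open>l\<close> of
  \[ |x_k|^2 |v_l|^2 - |\langle x_k, v_l\rangle|^2
     + \langle x_k, x_l\rangle \langle v_l, v_k\rangle
     - \langle x_k, v_k\rangle \langle v_l, x_l\rangle . \]
  The four summands come, in this order, from \<open>(tr A) I\<close>, \<open>(tr\<^sub>2 A) \<otimes> I\<close>, \<open>I \<otimes> (tr\<^sub>1 A)\<close> and \<open>A\<close>,
  and the Hadamard product with \<open>J\<close> removes exactly the pairs \<open>k = l\<close> (lemma \<open>sform_gap\<close>).  For
  \<open>k \<noteq> l\<close> the first two summands are the squared norm of the bivector \<open>x\<^sub>k \<and> v\<^sub>l\<close> and the last two
  its inner product with \<open>x\<^sub>l \<and> v\<^sub>k\<close>.  The pairs \<open>(k, l)\<close> and \<open>(l, k)\<close> together therefore contribute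
  the square \<open>|x\<^sub>k \<and> v\<^sub>l + x\<^sub>l \<and> v\<^sub>k|\<^sup>2\<close>.

  This identity carries over to every \<open>A\<close> by linearity.  The \<open>(i, j)\<close> coordinate of
  \<open>x\<^sub>k \<and> v\<^sub>l + x\<^sub>l \<and> v\<^sub>k\<close> is a linear functional of \<open>v\<close>, hence of the form \<open>w\<^sup>* v\<close> for an explicit
  vector \<open>w\<close> that depends on \<open>x\<close> (\<open>wedge_vector\<close>), and its squared modulus is \<open>w\<^sup>* A w\<close>.
  So, for every \<open>A\<close>, four times the quadratic form of the gap is the sum of \<open>w\<^sup>* A w\<close> over all
  \<open>i\<close>, \<open>j\<close> and all \<open>k \<noteq> l\<close> (lemma \<open>sum_gap_term_eq_sum_sform\<close>), which is nonnegative
  when \<open>A\<close> is positive semidefinite.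
\<close>

section \<open>Sesquilinear forms\<close>

definition sform :: "'n::finite cmatrix \<Rightarrow> complex ^ 'n \<Rightarrow> complex ^ 'n \<Rightarrow> complex" where
  "sform A u v = (\<Sum>p\<in>UNIV. \<Sum>q\<in>UNIV. cnj (u $ p) * A $ p $ q * v $ q)"

lemma psd_iff_sform: "psd A \<longleftrightarrow> hermitian A \<and> (\<forall>x. 0 \<le> Re (sform A x x))"
  by (simp add: psd_def sform_def matrix_vector_mult_def sum_distrib_left mult.assoc)

lemma sform_add_left: "sform A (u + v) w = sform A u w + sform A v w"
  by (simp add: sform_def distrib_right sum.distrib)

lemma sform_diff_left: "sform A (u - v) w = sform A u w - sform A v w"
  by (simp add: sform_def left_diff_distrib sum_subtractf)

lemma sform_add_right: "sform A w (u + v) = sform A w u + sform A w v"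
  by (simp add: sform_def distrib_left sum.distrib)

lemma sform_diff_right: "sform A w (u - v) = sform A w u - sform A w v"
  by (simp add: sform_def right_diff_distrib sum_subtractf)

lemma sform_axis: "sform A (axis p a) (axis q b) = cnj a * A $ p $ q * b"
proof -
  have "cnj (axis p a $ r) * A $ r $ s * axis q b $ s
      = (if s = q then if r = p then cnj a * A $ p $ q * b else 0 else 0)" for r s
    by (simp add: axis_def)
  then show ?thesis
    by (simp add: sform_def)
qed

lemma sform_matrix_add: "sform (A + B) u v = sform A u v + sform B u v"
  by (simp add: sform_def algebra_simps sum.distrib)

lemma sform_matrix_diff: "sform (A - B) u v = sform A u v - sform B u v"
  by (simp add: sform_def algebra_simps sum.distrib sum_subtractf)

lemma cscale_nth: "cscale c A $ i $ j = c * A $ i $ j"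
  by (simp add: cscale_def)

lemma sform_cscale: "sform (cscale c A) u v = c * sform A u v"
  by (simp add: sform_def cscale_nth sum_distrib_left algebra_simps)

section \<open>Entries and forms of the block matrices\<close>

lemma kronecker_nth: "kronecker X Y $ p $ q = X $ fst p $ fst q * Y $ snd p $ snd q"
  by (simp add: kronecker_def of_blocks_def cscale_nth)

lemma ptrace1_nth: "ptrace1 A $ k $ l = (\<Sum>i\<in>UNIV. A $ (i, k) $ (i, l))"
  by (simp add: ptrace1_def block_def)

lemma ptrace2_nth: "ptrace2 A $ i $ j = (\<Sum>k\<in>UNIV. A $ (i, k) $ (j, k))"
  by (simp add: ptrace2_def block_def trace_def)

lemma hadamard_nth: "hadamard A B $ i $ j = A $ i $ j * B $ i $ j"
  by (simp add: hadamard_def)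

lemma block_J_nth: "block_J $ p $ q = (if snd p = snd q then 1 else 0)"
  by (simp add: block_J_def of_blocks_def mat_def)

lemma sum_UNIV_prod:
  "(\<Sum>p\<in>UNIV. f p) = (\<Sum>i\<in>UNIV. \<Sum>k\<in>UNIV. f (i, k))"
  for f :: "'m::finite \<times> 'n::finite \<Rightarrow> 'c::comm_monoid_add"
  by (simp add: sum.cartesian_product flip: UNIV_Times_UNIV)

lemma trace_block: "trace A = (\<Sum>i\<in>UNIV. \<Sum>k\<in>UNIV. A $ (i, k) $ (i, k))"
  for A :: "('m::finite, 'n::finite) block_matrix"
  by (simp add: trace_def sum_UNIV_prod)

lemma sform_block:
  "sform M x x = (\<Sum>i\<in>UNIV. \<Sum>j\<in>UNIV. \<Sum>k\<in>UNIV. \<Sum>l\<in>UNIV.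
      cnj (x $ (i, k)) * M $ (i, k) $ (j, l) * x $ (j, l))"
  for M :: "('m::finite, 'n::finite) block_matrix"
  unfolding sform_def sum_UNIV_prod by (rule sum.cong[OF refl], rule sum.swap)

lemma sform_mat_1: "sform (mat 1) x x = (\<Sum>p\<in>UNIV. cnj (x $ p) * x $ p)"
proof -
  have "cnj (x $ p) * mat 1 $ p $ q * x $ q = (if p = q then cnj (x $ p) * x $ p else 0)" for p q
    by (simp add: mat_def)
  then show ?thesis by (simp add: sform_def)
qed

lemma sform_kronecker_mat_1_right:
  "sform (kronecker X (mat 1)) x x
     = (\<Sum>i\<in>UNIV. \<Sum>j\<in>UNIV. \<Sum>k\<in>UNIV. cnj (x $ (i, k)) * X $ i $ j * x $ (j, k))"
proof -
  have "cnj (x $ (i, k)) * kronecker X (mat 1) $ (i, k) $ (j, l) * x $ (j, l)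
      = (if k = l then cnj (x $ (i, k)) * X $ i $ j * x $ (j, k) else 0)" for i j k l
    by (simp add: kronecker_nth mat_def)
  then show ?thesis by (simp add: sform_block)
qed

lemma sform_kronecker_mat_1_left:
  "sform (kronecker (mat 1) Y) x x
     = (\<Sum>i\<in>UNIV. \<Sum>k\<in>UNIV. \<Sum>l\<in>UNIV. cnj (x $ (i, k)) * Y $ k $ l * x $ (i, l))"
proof -
  have "(\<Sum>k\<in>UNIV. \<Sum>l\<in>UNIV. cnj (x $ (i, k)) * kronecker (mat 1) Y $ (i, k) $ (j, l) * x $ (j, l))
      = (if i = j then \<Sum>k\<in>UNIV. \<Sum>l\<in>UNIV. cnj (x $ (i, k)) * Y $ k $ l * x $ (i, l) else 0)" for i j
    by (simp add: kronecker_nth mat_def)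
  then show ?thesis by (simp add: sform_block)
qed

lemma sform_hadamard_block_J:
  "sform (hadamard M block_J) x x
     = (\<Sum>i\<in>UNIV. \<Sum>j\<in>UNIV. \<Sum>k\<in>UNIV. cnj (x $ (i, k)) * M $ (i, k) $ (j, k) * x $ (j, k))"
proof -
  have "cnj (x $ (i, k)) * hadamard M block_J $ (i, k) $ (j, l) * x $ (j, l)
      = (if k = l then cnj (x $ (i, k)) * M $ (i, k) $ (j, k) * x $ (j, k) else 0)" for i j k l
    by (simp add: hadamard_nth block_J_nth)
  then show ?thesis by (simp add: sform_block)
qed

section \<open>Hermitian matrices\<close>

lemma hermitian_nth: "hermitian A \<Longrightarrow> cnj (A $ i $ j) = A $ j $ i"
  by (metis hermitian_def)

lemma hermitian_add: "hermitian A \<Longrightarrow> hermitian B \<Longrightarrow> hermitian (A + B)"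
  by (simp add: hermitian_def[of "A + B"] hermitian_nth)

lemma hermitian_diff: "hermitian A \<Longrightarrow> hermitian B \<Longrightarrow> hermitian (A - B)"
  by (simp add: hermitian_def[of "A - B"] hermitian_nth)

lemma hermitian_cscale: "cnj c = c \<Longrightarrow> hermitian A \<Longrightarrow> hermitian (cscale c A)"
  by (simp add: hermitian_def[of "cscale c A"] cscale_nth hermitian_nth)

lemma hermitian_mat_1: "hermitian (mat 1)"
  by (simp add: hermitian_def mat_def)

lemma hermitian_kronecker: "hermitian X \<Longrightarrow> hermitian Y \<Longrightarrow> hermitian (kronecker X Y)"
  by (simp add: hermitian_def[of "kronecker X Y"] kronecker_nth hermitian_nth)

lemma hermitian_hadamard: "hermitian A \<Longrightarrow> hermitian B \<Longrightarrow> hermitian (hadamard A B)"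
  by (simp add: hermitian_def[of "hadamard A B"] hadamard_nth hermitian_nth)

lemma hermitian_block_J: "hermitian block_J"
  by (simp add: hermitian_def block_J_nth)

lemma hermitian_ptrace1: "hermitian A \<Longrightarrow> hermitian (ptrace1 A)"
  by (simp add: hermitian_def[of "ptrace1 A"] ptrace1_nth hermitian_nth)

lemma hermitian_ptrace2: "hermitian A \<Longrightarrow> hermitian (ptrace2 A)"
  by (simp add: hermitian_def[of "ptrace2 A"] ptrace2_nth hermitian_nth)

lemma cnj_trace_hermitian: "hermitian A \<Longrightarrow> cnj (trace A) = trace A"
  by (simp add: trace_def hermitian_nth)

section \<open>The gap as a sum of squares\<close>

text \<open>
  Summed over all four indices, the summands give the forms of \<open>(tr A) I\<close>, \<open>(tr\<^sub>2 A) \<otimes> I\<close>,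
  \<open>I \<otimes> (tr\<^sub>1 A)\<close> and \<open>A\<close>.  Equivalently, they are \<open>u\<^sup>* A w\<close>, where \<open>w\<close> is the wedge vector
  defined next and \<open>u\<close> is the first of its four components.
\<close>

definition gap_term ::
  "('m::finite, 'n::finite) block_matrix \<Rightarrow> complex ^ ('m \<times> 'n) \<Rightarrow> 'm \<Rightarrow> 'm \<Rightarrow> 'n \<Rightarrow> 'n \<Rightarrow> complex" where
  "gap_term A x i j k l =
     cnj (x $ (i, k)) * A $ (j, l) $ (j, l) * x $ (i, k)
   - cnj (x $ (j, k)) * A $ (j, l) $ (i, l) * x $ (i, k)
   + cnj (x $ (i, l)) * A $ (j, l) $ (j, k) * x $ (i, k)
   - cnj (x $ (j, l)) * A $ (j, l) $ (i, k) * x $ (i, k)"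

text \<open>
  This is the vector \<open>w\<close> such that, for all \<open>v\<close>,
  \<open>w\<^sup>* v = x\<^sub>i\<^sub>k v\<^sub>j\<^sub>l - x\<^sub>j\<^sub>k v\<^sub>i\<^sub>l + x\<^sub>i\<^sub>l v\<^sub>j\<^sub>k - x\<^sub>j\<^sub>l v\<^sub>i\<^sub>k\<close>, the \<open>(i, j)\<close> coordinate of
  \<open>x\<^sub>k \<and> v\<^sub>l + x\<^sub>l \<and> v\<^sub>k\<close>.  The entries of \<open>x\<close> are conjugated because \<open>w\<^sup>*\<close> conjugates them back.
\<close>

definition wedge_vector ::
  "complex ^ ('m \<times> 'n) \<Rightarrow> 'm::finite \<Rightarrow> 'm \<Rightarrow> 'n::finite \<Rightarrow> 'n \<Rightarrow> complex ^ ('m \<times> 'n)" where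
  "wedge_vector x i j k l =
     axis (j, l) (cnj (x $ (i, k))) - axis (i, l) (cnj (x $ (j, k)))
   + axis (j, k) (cnj (x $ (i, l))) - axis (i, k) (cnj (x $ (j, l)))"

text \<open>
  Exchanging \<open>i\<close> with \<open>j\<close> negates the wedge vector, and exchanging \<open>k\<close> with \<open>l\<close> fixes it.
  The four components of the left argument are thus, up to sign, the images of the first one under
  these exchanges, and the sixteen products group into four gap terms.
\<close>

lemma sform_wedge_vector:
  "sform A (wedge_vector x i j k l) (wedge_vector x i j k l)
     = gap_term A x i j k l + gap_term A x j i k l
     + gap_term A x i j l k + gap_term A x j i l k"
  unfolding wedge_vector_def gap_term_def
  by (simp add: sform_add_left sform_diff_left sform_add_right sform_diff_right sform_axis)

text \<open>
  The index range \<open>k \<noteq> l\<close> is stable under both exchanges, so each of the four gap terms has the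
  same sum.
\<close>

lemma sum_gap_term_eq_sum_sform:
  fixes x :: "complex ^ ('m::finite \<times> 'n::finite)"
  shows "4 * (\<Sum>i\<in>UNIV. \<Sum>j\<in>UNIV. \<Sum>k\<in>UNIV. \<Sum>l\<in>UNIV. if k = l then 0 else gap_term A x i j k l)
       = (\<Sum>i\<in>UNIV. \<Sum>j\<in>UNIV. \<Sum>k\<in>UNIV. \<Sum>l\<in>UNIV. if k = l then 0
            else sform A (wedge_vector x i j k l) (wedge_vector x i j k l))"
    (is "4 * ?S = ?R")
proof -
  define g where "g i j k l = (if k = l then 0 else gap_term A x i j k l)" for i j k l
  have S: "?S = (\<Sum>i\<in>UNIV. \<Sum>j\<in>UNIV. \<Sum>k\<in>UNIV. \<Sum>l\<in>UNIV. g i j k l)"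
    by (simp add: g_def)
  have "?R = (\<Sum>i\<in>UNIV. \<Sum>j\<in>UNIV. \<Sum>k\<in>UNIV. \<Sum>l\<in>UNIV. g i j k l + g j i k l + g i j l k + g j i l k)"
    by (intro sum.cong refl) (auto simp: g_def sform_wedge_vector)
  also have "\<dots> = ?S + (\<Sum>i\<in>UNIV. \<Sum>j\<in>UNIV. \<Sum>k\<in>UNIV. \<Sum>l\<in>UNIV. g j i k l)
      + (\<Sum>i\<in>UNIV. \<Sum>j\<in>UNIV. \<Sum>k\<in>UNIV. \<Sum>l\<in>UNIV. g i j l k)
      + (\<Sum>i\<in>UNIV. \<Sum>j\<in>UNIV. \<Sum>k\<in>UNIV. \<Sum>l\<in>UNIV. g j i l k)"
    by (simp add: S sum.distrib)
  also have "(\<Sum>i\<in>UNIV. \<Sum>j\<in>UNIV. \<Sum>k\<in>UNIV. \<Sum>l\<in>UNIV. g j i k l) = ?S"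
    unfolding S by (rule sum.swap)
  also have swap_kl: "(\<Sum>i\<in>UNIV. \<Sum>j\<in>UNIV. \<Sum>k\<in>UNIV. \<Sum>l\<in>UNIV. g i j l k) = ?S"
    unfolding S by (rule sum.cong[OF refl], rule sum.cong[OF refl], rule sum.swap)
  also have "(\<Sum>i\<in>UNIV. \<Sum>j\<in>UNIV. \<Sum>k\<in>UNIV. \<Sum>l\<in>UNIV. g j i l k) = ?S"
    unfolding swap_kl[symmetric] by (rule sum.swap)
  finally show ?thesis by simp
qed

lemma sum_gap_term_nonneg:
  assumes "psd A"
  shows "0 \<le> Re (\<Sum>i\<in>UNIV. \<Sum>j\<in>UNIV. \<Sum>k\<in>UNIV. \<Sum>l\<in>UNIV. if k = l then 0 else gap_term A x i j k l)"
    (is "0 \<le> Re ?S")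
proof -
  have "0 \<le> Re (4 * ?S)"
    unfolding sum_gap_term_eq_sum_sform
    using assms by (auto simp: psd_iff_sform intro!: sum_nonneg)
  then show ?thesis by simp
qed

text \<open>
  The four main matrices give the sum of the gap terms over all indices.  The Hadamard correction
  sees only entries with equal inner indices and is the sum over \<open>k = l\<close>.
\<close>

lemma sform_gap:
  fixes A :: "('m::finite, 'n::finite) block_matrix"
  shows "sform (cscale (trace A) (mat 1) - kronecker (ptrace2 A) (mat 1)
           - (A - kronecker (mat 1) (ptrace1 A)
              + cscale 2 (hadamard (kronecker (mat 1) (ptrace1 A) - A) block_J))) x x
     = (\<Sum>i\<in>UNIV. \<Sum>j\<in>UNIV. \<Sum>k\<in>UNIV. \<Sum>l\<in>UNIV. if k = l then 0 else gap_term A x i j k l)"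
proof -
  let ?N = "cscale (trace A) (mat 1) :: ('m, 'n) block_matrix"
  let ?P = "kronecker (ptrace2 A) (mat 1) :: ('m, 'n) block_matrix"
  let ?K = "kronecker (mat 1) (ptrace1 A)"
  let ?H = "hadamard (?K - A) block_J"
  have norm_part: "sform ?N x x = (\<Sum>i\<in>UNIV. \<Sum>j\<in>UNIV. \<Sum>k\<in>UNIV. \<Sum>l\<in>UNIV.
      cnj (x $ (i, k)) * A $ (j, l) $ (j, l) * x $ (i, k))"
  proof -
    have "sform ?N x x = (\<Sum>i\<in>UNIV. \<Sum>k\<in>UNIV. \<Sum>j\<in>UNIV. \<Sum>l\<in>UNIV.
      cnj (x $ (i, k)) * A $ (j, l) $ (j, l) * x $ (i, k))"
      by (simp add: sform_cscale sform_mat_1 sum_UNIV_prod trace_block sum_distrib_left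
          sum_distrib_right mult_ac)
    then show ?thesis by (subst sum.swap[where A="UNIV::'m set" and B="UNIV::'n set"]) simp
  qed
  have ptrace2_part: "sform ?P x x = (\<Sum>i\<in>UNIV. \<Sum>j\<in>UNIV. \<Sum>k\<in>UNIV. \<Sum>l\<in>UNIV.
      cnj (x $ (j, k)) * A $ (j, l) $ (i, l) * x $ (i, k))"
    unfolding sform_kronecker_mat_1_right ptrace2_nth sum_distrib_left sum_distrib_right
    by (rule sum.swap)
  have ptrace1_part: "sform ?K x x = (\<Sum>i\<in>UNIV. \<Sum>j\<in>UNIV. \<Sum>k\<in>UNIV. \<Sum>l\<in>UNIV.
      cnj (x $ (i, l)) * A $ (j, l) $ (j, k) * x $ (i, k))"
  proof -
    have "sform ?K x x = (\<Sum>i\<in>UNIV. \<Sum>l\<in>UNIV. \<Sum>k\<in>UNIV. \<Sum>j\<in>UNIV.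
      cnj (x $ (i, l)) * A $ (j, l) $ (j, k) * x $ (i, k))"
      unfolding sform_kronecker_mat_1_left ptrace1_nth sum_distrib_left sum_distrib_right ..
    also have "\<dots> = (\<Sum>i\<in>UNIV. \<Sum>k\<in>UNIV. \<Sum>l\<in>UNIV. \<Sum>j\<in>UNIV.
      cnj (x $ (i, l)) * A $ (j, l) $ (j, k) * x $ (i, k))"
      by (rule sum.cong[OF refl], rule sum.swap)
    also have "\<dots> = (\<Sum>i\<in>UNIV. \<Sum>k\<in>UNIV. \<Sum>j\<in>UNIV. \<Sum>l\<in>UNIV.
      cnj (x $ (i, l)) * A $ (j, l) $ (j, k) * x $ (i, k))"
      by (rule sum.cong[OF refl], rule sum.cong[OF refl], rule sum.swap)
    also have "\<dots> = (\<Sum>i\<in>UNIV. \<Sum>j\<in>UNIV. \<Sum>k\<in>UNIV. \<Sum>l\<in>UNIV.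
      cnj (x $ (i, l)) * A $ (j, l) $ (j, k) * x $ (i, k))"
      by (rule sum.cong[OF refl], rule sum.swap)
    finally show ?thesis .
  qed
  have A_part: "sform A x x = (\<Sum>i\<in>UNIV. \<Sum>j\<in>UNIV. \<Sum>k\<in>UNIV. \<Sum>l\<in>UNIV.
      cnj (x $ (j, l)) * A $ (j, l) $ (i, k) * x $ (i, k))"
  proof -
    have "sform A x x = (\<Sum>j\<in>UNIV. \<Sum>i\<in>UNIV. \<Sum>k\<in>UNIV. \<Sum>l\<in>UNIV.
      cnj (x $ (j, l)) * A $ (j, l) $ (i, k) * x $ (i, k))"
      unfolding sform_block by (rule sum.cong[OF refl], rule sum.cong[OF refl], rule sum.swap)
    also have "\<dots> = (\<Sum>i\<in>UNIV. \<Sum>j\<in>UNIV. \<Sum>k\<in>UNIV. \<Sum>l\<in>UNIV.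
      cnj (x $ (j, l)) * A $ (j, l) $ (i, k) * x $ (i, k))"
      by (rule sum.swap)
    finally show ?thesis .
  qed
  have hadamard_part: "2 * sform ?H x x = (\<Sum>i\<in>UNIV. \<Sum>j\<in>UNIV. \<Sum>k\<in>UNIV. gap_term A x i j k k)"
  proof -
    have K: "(\<Sum>j\<in>UNIV. \<Sum>k\<in>UNIV. cnj (x $ (i, k)) * ?K $ (i, k) $ (j, k) * x $ (j, k))
        = (\<Sum>j\<in>UNIV. \<Sum>k\<in>UNIV. cnj (x $ (i, k)) * A $ (j, k) $ (j, k) * x $ (i, k))" for i
    proof -
      have "(\<Sum>k\<in>UNIV. cnj (x $ (i, k)) * ?K $ (i, k) $ (j, k) * x $ (j, k))
          = (if i = j then \<Sum>k\<in>UNIV. cnj (x $ (i, k)) * ptrace1 A $ k $ k * x $ (i, k) else 0)" for j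
        by (simp add: kronecker_nth mat_def)
      then have "(\<Sum>j\<in>UNIV. \<Sum>k\<in>UNIV. cnj (x $ (i, k)) * ?K $ (i, k) $ (j, k) * x $ (j, k))
          = (\<Sum>k\<in>UNIV. \<Sum>j\<in>UNIV. cnj (x $ (i, k)) * A $ (j, k) $ (j, k) * x $ (i, k))"
        by (simp add: ptrace1_nth sum_distrib_left sum_distrib_right)
      then show ?thesis by (subst sum.swap)
    qed
    have "sform ?H x x
        = (\<Sum>i\<in>UNIV. \<Sum>j\<in>UNIV. \<Sum>k\<in>UNIV. cnj (x $ (i, k)) * ?K $ (i, k) $ (j, k) * x $ (j, k))
        - (\<Sum>i\<in>UNIV. \<Sum>j\<in>UNIV. \<Sum>k\<in>UNIV. cnj (x $ (i, k)) * A $ (i, k) $ (j, k) * x $ (j, k))"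
      unfolding sform_hadamard_block_J by (simp add: algebra_simps sum_subtractf)
    also have "(\<Sum>i\<in>UNIV. \<Sum>j\<in>UNIV. \<Sum>k\<in>UNIV. cnj (x $ (i, k)) * A $ (i, k) $ (j, k) * x $ (j, k))
        = (\<Sum>i\<in>UNIV. \<Sum>j\<in>UNIV. \<Sum>k\<in>UNIV. cnj (x $ (j, k)) * A $ (j, k) $ (i, k) * x $ (i, k))"
      by (rule sum.swap)
    finally have H: "sform ?H x x
        = (\<Sum>i\<in>UNIV. \<Sum>j\<in>UNIV. \<Sum>k\<in>UNIV. cnj (x $ (i, k)) * A $ (j, k) $ (j, k) * x $ (i, k))
        - (\<Sum>i\<in>UNIV. \<Sum>j\<in>UNIV. \<Sum>k\<in>UNIV. cnj (x $ (j, k)) * A $ (j, k) $ (i, k) * x $ (i, k))"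
      by (simp only: K)
    \<comment> \<open>On the diagonal the four summands of the gap term coincide in pairs; this is where the
      factor 2 in front of the Hadamard product comes from.\<close>
    have "gap_term A x i j k k = 2 * (cnj (x $ (i, k)) * A $ (j, k) $ (j, k) * x $ (i, k))
        - 2 * (cnj (x $ (j, k)) * A $ (j, k) $ (i, k) * x $ (i, k))" for i j k
      by (simp add: gap_term_def)
    then show ?thesis
      by (simp only: H right_diff_distrib sum_subtractf sum_distrib_left)
  qed
  have "(if k = l then 0 else gap_term A x i j k l)
      = gap_term A x i j k l - (if k = l then gap_term A x i j k k else 0)" for i j k l
    by simp
  then have "(\<Sum>i\<in>UNIV. \<Sum>j\<in>UNIV. \<Sum>k\<in>UNIV. \<Sum>l\<in>UNIV. if k = l then 0 else gap_term A x i j k l)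
      = (\<Sum>i\<in>UNIV. \<Sum>j\<in>UNIV. \<Sum>k\<in>UNIV. \<Sum>l\<in>UNIV. gap_term A x i j k l)
      - (\<Sum>i\<in>UNIV. \<Sum>j\<in>UNIV. \<Sum>k\<in>UNIV. gap_term A x i j k k)"
    by (simp only: sum_subtractf) simp
  also have "(\<Sum>i\<in>UNIV. \<Sum>j\<in>UNIV. \<Sum>k\<in>UNIV. \<Sum>l\<in>UNIV. gap_term A x i j k l)
      = sform ?N x x - sform ?P x x + sform ?K x x - sform A x x"
    unfolding norm_part ptrace2_part ptrace1_part A_part gap_term_def
    by (simp only: sum.distrib sum_subtractf)
  finally show ?thesis
    by (simp add: sform_matrix_add sform_matrix_diff sform_cscale[of 2] hadamard_part)
qed

theorem theorem4p2:
  fixes A :: "('m::finite, 'n::finite) block_matrix"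
  assumes "psd A"
  shows "loewner_ge
           (cscale (trace A) (mat 1) - kronecker (ptrace2 A) (mat 1))
           (A - kronecker (mat 1) (ptrace1 A)
              + cscale 2 (hadamard (kronecker (mat 1) (ptrace1 A) - A) block_J))"
proof -
  have A: "hermitian A"
    using assms by (simp add: psd_def)
  let ?X = "cscale (trace A) (mat 1) - kronecker (ptrace2 A) (mat 1) :: ('m, 'n) block_matrix"
  let ?Y = "A - kronecker (mat 1) (ptrace1 A)
    + cscale 2 (hadamard (kronecker (mat 1) (ptrace1 A) - A) block_J)"
  have X: "hermitian ?X"
    by (intro hermitian_diff hermitian_cscale hermitian_kronecker hermitian_mat_1
        hermitian_ptrace2 cnj_trace_hermitian A)
  have Y: "hermitian ?Y"
    by (intro hermitian_add hermitian_diff hermitian_cscale hermitian_hadamard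
        hermitian_kronecker hermitian_mat_1 hermitian_block_J hermitian_ptrace1 A) simp
  have "0 \<le> Re (sform (?X - ?Y) x x)" for x
    unfolding sform_gap by (rule sum_gap_term_nonneg[OF assms])
  with X Y show ?thesis
    by (simp add: loewner_ge_def psd_iff_sform hermitian_diff)
qed

end
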